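(* For the problem $\operatorname{INF}:2^{\mathbb N}\to\{0,1\}$ deciding whether a binary sequence contains infinitely many ones, $$\operatorname{INF}\equiv_{\mathrm{sW}}\operatorname{LPO}',\qquad \operatorname{SCI}^{\lim}_{\mathrm{Comp}}(P_{\operatorname{INF}})=\operatorname{rk}_{\lim}(\operatorname{INF})=2.$$ Moreover, $$\operatorname{INF}<_{\mathrm W}\operatorname{Lim}^{(2)},\qquad \operatorname{INF}\nleq_{\mathrm W}\operatorname{Lim},\qquad \operatorname{Lim}\nleq_{\mathrm W}\operatorname{INF}.$$
   Context: Conventions. $\mathbb N=\{0,1,2,\dots\}$; a computable bijective pairing $\langle\cdot,\cdot\rangle:\mathbb N^2\to\mathbb N$ is fixed. Computability of partial functionals on Baire space $\mathbb N^{\mathbb N}$ is in the Type-2 sense. A representation of $X$ is a partial surjection $\delta_X:\subseteq\mathbb N^{\mathbb N}\to X$; $p$ is a name of $\delta_X(p)$. Cantor space $2^{\mathbb N}$ has its identity representation, and $2=\{0,1\}$ has the discrete representation $\delta_2(p)=p(0)$ when $p(0)\in\{0,1\}$. For represented problems $f:\subseteq X\rightrightarrows Y$, $g:\subseteq U\rightrightarrows V$: a realizer of $g$ sends each name of each $u\in\operatorname{dom}(g)$ to a name of an element of $g(u)$. $f\leq_{\mathrm W}g$ (resp. $f\leq_{\mathrm{sW}}g$) means there are computable partial functionals $K,H$ such that for every realizer $G$ of $g$, $p\mapsto H(p,G(K(p)))$ (resp. $p\mapsto H(G(K(p)))$) realizes $f$. $\equiv$ denotes mutual reducibility; $f<_{\mathrm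 W}g$ means $f\leq_{\mathrm W}g$ and $g\nleq_{\mathrm W}f$. $\operatorname{Lim}(P)(j)=\lim_{s\to\infty}P(\langle s,j\rangle)$ on $\mathbb N^{\mathbb N}$, with domain those $P$ for which every column $s\mapsto P(\langle s,j\rangle)$ is eventually constant. $\operatorname{Lim}^{(0)}=\mathrm{id}$, $\operatorname{Lim}^{(k+1)}=\operatorname{Lim}\circ\operatorname{Lim}^{(k)}$, and $\operatorname{rk}_{\lim}(f)=\min\{k:f\leq_{\mathrm W}\operatorname{Lim}^{(k)}\}$ ($\infty$ if none). $\operatorname{INF}(a)=1$ if $\forall N\,\exists j\geq N\ a(j)=1$, and $\operatorname{INF}(a)=0$ otherwise. $P_{\operatorname{INF}}$ is the SCI problem with domain $2^{\mathbb N}$, discrete target $2$, target map $\operatorname{INF}$, and evaluations $\lambda_j(a)=a(j)$. Its represented version has as inputs the evaluation tables $(\lambda_j(a))_j$ with the subspace product Cauchy representation, which is computably equivalent to the identity representation of Cantor space (so $\operatorname{INF}$ may be taken with the latter). $\operatorname{LPO}:2^{\mathbb N}\to2$ is $\operatorname{LPO}(u)=1$ if some $u(t)=1$, and $0$ otherwise. The derivative $g'$ of a represented problem $g$ is the same relation with input representation $\delta$ replaced by $\delta\circ\operatorname{Lim}$ and unchanged output representation. Thus (equivalently) $\operatorname{LPO}'$ receives a binary array $(p_s(j))$ with each $j$-column eventually constant in $s$ and returns $\operatorname{LPO}(u)$, $u(j)=\lim_sp_s(j)$. $\operatorname{SCI}^{\lim}_{\mathrm{Comp}}(P_{\operatorname{INF}})$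 is the least $k\in\mathbb N$ for which there is a computable partial functional $K$ on $\mathbb N^{\mathbb N}$ such that for every input name $p$ of every $a\in2^{\mathbb N}$, $\operatorname{Lim}^{(k)}(K(p))$ is defined and is a $\delta_2$-name of $\operatorname{INF}(a)$ ($\infty$ if no such $k$). *)

theory Defs
  imports Complex_Main "HOL-Library.Nat_Bijection" "HOL-Library.Extended_Nat"
begin

section \<open>Type-2 computability on Baire space\<close>

type_synonym baire = "nat \<Rightarrow> nat"

text \<open>Codes for partial recursive functions with access to an oracle. Arguments are passed as
  lists; a code applied to too few arguments is undefined.\<close>

datatype orec =
    Zero
  | Succ
  | Proj nat
  | Query
  | Comp orec "orec list"
  | PrimRec orec orec
  | Minim orec

fun run :: "orec \<Rightarrow> baire \<Rightarrow> nat list \<Rightarrow> nat option" where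
  "run Zero p xs = Some 0"
| "run Succ p xs = (case xs of [] \<Rightarrow> None | x # _ \<Rightarrow> Some (Suc x))"
| "run (Proj i) p xs = (if i < length xs then Some (xs ! i) else None)"
| "run Query p xs = (case xs of [] \<Rightarrow> None | x # _ \<Rightarrow> Some (p x))"
| "run (Comp f gs) p xs = Option.bind (those (map (\<lambda>g. run g p xs) gs)) (run f p)"
| "run (PrimRec f g) p xs =
     (case xs of
        [] \<Rightarrow> None
      | n # ys \<Rightarrow> rec_nat (run f p ys) (\<lambda>m r. Option.bind r (\<lambda>y. run g p (m # y # ys))) n)"
| "run (Minim f) p xs =
     (if \<exists>n. run f p (n # xs) = Some 0 \<and> (\<forall>m<n. run f p (m # xs) \<noteq> None)
      then Some (LEAST n. run f p (n # xs) = Some 0) else None)"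

text \<open>The functional computed by a code maps the oracle \<open>p\<close> to the sequence of outputs on
  \<open>0, 1, 2, \<dots>\<close>; as for Type-2 machines, its domain consists of exactly those \<open>p\<close> on which
  infinite output is produced.\<close>

definition functional :: "orec \<Rightarrow> (baire \<rightharpoonup> baire)" where
  "functional e p =
     (if \<forall>n. run e p [n] \<noteq> None then Some (\<lambda>n. the (run e p [n])) else None)"

definition computable :: "(baire \<rightharpoonup> baire) \<Rightarrow> bool" where
  "computable F \<longleftrightarrow> (\<exists>e. F = functional e)"

text \<open>Functionals of two arguments are functionals of one argument through the interleaving
  \<open>p 0, q 0, p 1, q 1, \<dots>\<close>.\<close>

definition join :: "baire \<Rightarrow> baire \<Rightarrow> baire" where
  "join p q n = (if even n then p (n div 2) else q (n div 2))"


section \<open>Represented problems and Weihrauch reducibility\<close>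

text \<open>The represented set is the range of the representation.\<close>

type_synonym 'a representation = "baire \<rightharpoonup> 'a"

text \<open>A partial multivalued map is a set-valued function; its domain is where the value is
  nonempty.\<close>

record ('a, 'b) problem =
  in_rep :: "'a representation"
  out_rep :: "'b representation"
  solutions :: "'a \<Rightarrow> 'b set"

definition realizes :: "(baire \<rightharpoonup> baire) \<Rightarrow> ('a, 'b) problem \<Rightarrow> bool" where
  "realizes G g \<longleftrightarrow>
     (\<forall>p u. in_rep g p = Some u \<and> solutions g u \<noteq> {} \<longrightarrow>
        (\<exists>q v. G p = Some q \<and> out_rep g q = Some v \<and> v \<in> solutions g u))"

definition weihrauch_le :: "('a, 'b) problem \<Rightarrow> ('c, 'd) problem \<Rightarrow> bool"
    (infix "\<le>\<^sub>W" 50) where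
  "f \<le>\<^sub>W g \<longleftrightarrow>
     (\<exists>K H. computable K \<and> computable H \<and>
        (\<forall>G. realizes G g \<longrightarrow>
           realizes (\<lambda>p. Option.bind (Option.bind (K p) G) (\<lambda>q. H (join p q))) f))"

definition strong_weihrauch_le :: "('a, 'b) problem \<Rightarrow> ('c, 'd) problem \<Rightarrow> bool"
    (infix "\<le>\<^sub>s\<^sub>W" 50) where
  "f \<le>\<^sub>s\<^sub>W g \<longleftrightarrow>
     (\<exists>K H. computable K \<and> computable H \<and>
        (\<forall>G. realizes G g \<longrightarrow>
           realizes (\<lambda>p. Option.bind (Option.bind (K p) G) H) f))"

definition strong_weihrauch_equiv :: "('a, 'b) problem \<Rightarrow> ('c, 'd) problem \<Rightarrow> bool"
    (infix "\<equiv>\<^sub>s\<^sub>W" 50) where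
  "f \<equiv>\<^sub>s\<^sub>W g \<longleftrightarrow> f \<le>\<^sub>s\<^sub>W g \<and> g \<le>\<^sub>s\<^sub>W f"

definition weihrauch_less :: "('a, 'b) problem \<Rightarrow> ('c, 'd) problem \<Rightarrow> bool"
    (infix "<\<^sub>W" 50) where
  "f <\<^sub>W g \<longleftrightarrow> f \<le>\<^sub>W g \<and> \<not> g \<le>\<^sub>W f"


section \<open>The limit operator, limit rank and derivatives\<close>

text \<open>The limit in the value is that of the discrete topology on \<^typ>\<open>nat\<close>.\<close>

definition limit_op :: "baire \<rightharpoonup> baire" where
  "limit_op P =
     (if \<forall>j. \<exists>c. \<forall>\<^sub>F s in sequentially. P (prod_encode (s, j)) = c
      then Some (\<lambda>j. lim (\<lambda>s. P (prod_encode (s, j)))) else None)"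

primrec limit_iter :: "nat \<Rightarrow> (baire \<rightharpoonup> baire)" where
  "limit_iter 0 = Some"
| "limit_iter (Suc k) = limit_op \<circ>\<^sub>m limit_iter k"

definition baire_problem :: "(baire \<rightharpoonup> baire) \<Rightarrow> (baire, baire) problem" where
  "baire_problem F = \<lparr>in_rep = Some, out_rep = Some, solutions = (\<lambda>p. set_option (F p))\<rparr>"

definition Lim_problem :: "(baire, baire) problem" where
  "Lim_problem = baire_problem limit_op"

definition Lim_iter_problem :: "nat \<Rightarrow> (baire, baire) problem" where
  "Lim_iter_problem k = baire_problem (limit_iter k)"

text \<open>The infimum of the empty set is \<open>\<infinity>\<close>.\<close>

definition rk_lim :: "('a, 'b) problem \<Rightarrow> enat" where
  "rk_lim f = Inf (enat ` {k. f \<le>\<^sub>W Lim_iter_problem k})"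

definition derivative :: "('a, 'b) problem \<Rightarrow> ('a, 'b) problem" where
  "derivative g = g\<lparr>in_rep := in_rep g \<circ>\<^sub>m limit_op\<rparr>"


section \<open>INF and LPO\<close>

definition cantor :: "baire set" where
  "cantor = {a. \<forall>n. a n \<in> {0, 1}}"

definition cantor_rep :: "baire representation" where
  "cantor_rep p = (if p \<in> cantor then Some p else None)"

definition two_rep :: "nat representation" where
  "two_rep p = (if p 0 \<in> {0, 1} then Some (p 0) else None)"

definition cantor_problem :: "(baire \<Rightarrow> nat) \<Rightarrow> (baire, nat) problem" where
  "cantor_problem \<phi> =
     \<lparr>in_rep = cantor_rep, out_rep = two_rep,
      solutions = (\<lambda>a. if a \<in> cantor then {\<phi> a} else {})\<rparr>"

definition inf_map :: "baire \<Rightarrow> nat" where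
  "inf_map a = (if \<forall>N. \<exists>j\<ge>N. a j = 1 then 1 else 0)"

definition lpo_map :: "baire \<Rightarrow> nat" where
  "lpo_map u = (if \<exists>t. u t = 1 then 1 else 0)"

definition INF_problem :: "(baire, nat) problem" where
  "INF_problem = cantor_problem inf_map"

definition LPO_problem :: "(baire, nat) problem" where
  "LPO_problem = cantor_problem lpo_map"


section \<open>SCI problems\<close>

text \<open>Evaluations are complex valued. The metric of the target space enters only through its
  representation.\<close>

record ('a, 'b) sci_problem =
  sci_dom :: "'a set"
  sci_map :: "'a \<Rightarrow> 'b"
  sci_eval :: "nat \<Rightarrow> 'a \<Rightarrow> complex"
  sci_target_rep :: "'b representation"

definition rat_of_code :: "nat \<Rightarrow> real" where
  "rat_of_code n =
     (let (m, d) = prod_decode n; (u, v) = prod_decode m in (real u - real v) / (real d + 1))"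

definition complex_of_code :: "nat \<Rightarrow> complex" where
  "complex_of_code n = (let (x, y) = prod_decode n in Complex (rat_of_code x) (rat_of_code y))"

definition cauchy_rep :: "complex representation" where
  "cauchy_rep p =
     (if \<exists>z. \<forall>n. cmod (complex_of_code (p n) - z) \<le> 1 / 2 ^ n
      then Some (THE z. \<forall>n. cmod (complex_of_code (p n) - z) \<le> 1 / 2 ^ n) else None)"

definition product_rep :: "'a representation \<Rightarrow> (nat \<Rightarrow> 'a) representation" where
  "product_rep \<delta> p =
     (if \<forall>j. \<delta> (\<lambda>n. p (prod_encode (j, n))) \<noteq> None
      then Some (\<lambda>j. the (\<delta> (\<lambda>n. p (prod_encode (j, n))))) else None)"

definition subspace_rep :: "'a set \<Rightarrow> 'a representation \<Rightarrow> 'a representation" where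
  "subspace_rep A \<delta> p = (case \<delta> p of None \<Rightarrow> None | Some x \<Rightarrow> if x \<in> A then Some x else None)"

definition eval_table :: "('a, 'b) sci_problem \<Rightarrow> 'a \<Rightarrow> (nat \<Rightarrow> complex)" where
  "eval_table P a = (\<lambda>j. sci_eval P j a)"

definition table_rep :: "('a, 'b) sci_problem \<Rightarrow> (nat \<Rightarrow> complex) representation" where
  "table_rep P = subspace_rep (eval_table P ` sci_dom P) (product_rep cauchy_rep)"

definition SCI_lim_Comp :: "('a, 'b) sci_problem \<Rightarrow> enat" where
  "SCI_lim_Comp P =
     Inf (enat ` {k. \<exists>K. computable K \<and>
        (\<forall>a\<in>sci_dom P. \<forall>p. table_rep P p = Some (eval_table P a) \<longrightarrow>
           (\<exists>q. (limit_iter k \<circ>\<^sub>m K) p = Some q \<and> sci_target_rep P q = Some (sci_map P a)))})"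

definition P_INF :: "(baire, nat) sci_problem" where
  "P_INF = \<lparr>sci_dom = cantor, sci_map = inf_map, sci_eval = (\<lambda>j a. of_nat (a j)),
            sci_target_rep = two_rep\<rparr>"

end

theory Submission
  imports Defs
begin

text \<open>
  INF asks a question of the form ``for all N there is j'', that is, a $\Pi_2$ question, and
  everything below is a consequence of its exact position in the arithmetical hierarchy.

  \<^bold>\<open>Upper bounds.\<close> The matrix ``some one occurs in $[s, t]$'' is decidable; its limit for
  $t \to \infty$ is ``some one occurs at or after $s$'', and the limit of that for $s \to \infty$ is
  INF. This writes INF as a double limit (\<open>limit_iter_double_limit_name\<close>), and the inner limit
  alone turns INF into the negation of LPO (\<open>INF_le_derivative_LPO\<close>). Conversely
  LPO of a limit is a $\Sigma_2$ question: some column is eventually one. A counter runs through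
  candidate columns, visiting each infinitely often, and moves on whenever the present candidate is
  refuted. It moves infinitely often iff there is no correct candidate
  (\<open>inf_map_refutations\<close>).

  \<^bold>\<open>One limit is not enough.\<close> If a continuous functional could compute INF from a single limit of
  a continuous functional, then the set of sequences with infinitely many ones would be a countable
  union of closed sets: for every finite prefix of the limit and every bound on the time from which
  that prefix is stable, take the sequences for which prefix and bound are correct and force the
  answer 1. But sequences with finitely many ones are dense, so each of these closed sets would be
  nowhere dense, and the Baire category argument produces a sequence with infinitely many ones outside
  all of them (\<open>INF_not_countable_union_of_closed\<close>). This only uses continuity, so
  it applies to Weihrauch reductions and to limits of functionals on evaluation tables alike
  (\<open>INF_not_single_limit\<close>).

  \<^bold>\<open>INF does not compute limits.\<close> An oracle with the two possible answers 0 and 1 leaves a reduction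
  only two candidate outputs, whereas finitely many positions of an input never determine its
  limit: changing the limit from 0 to 1 to 2 outruns both candidates
  (\<open>baire_problem_not_le_cantor_problem\<close>).
\<close>


section \<open>Total recursive functions relative to an oracle\<close>

text \<open>The reductions all use total functionals. Keeping the oracle and the argument list as bound
  variables makes the closure properties below usable as introduction rules that read a code off
  the defining term.\<close>

definition recursive :: "nat \<Rightarrow> (baire \<Rightarrow> nat list \<Rightarrow> nat) \<Rightarrow> bool" where
  "recursive k f \<longleftrightarrow> (\<exists>e. \<forall>p xs. length xs = k \<longrightarrow> run e p xs = Some (f p xs))"

lemma recursiveI: "(\<And>p xs. length xs = k \<Longrightarrow> run e p xs = Some (f p xs)) \<Longrightarrow> recursive k f"
  unfolding recursive_def by blast

lemma recursiveE:
  assumes "recursive k f"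
  obtains e where "\<And>p xs. length xs = k \<Longrightarrow> run e p xs = Some (f p xs)"
  using assms unfolding recursive_def by blast

lemma computable_if_recursive:
  assumes "recursive 1 (\<lambda>p xs. f p (xs ! 0))"
  shows "computable (\<lambda>p. Some (f p))"
proof -
  obtain e where e: "\<And>p xs. length xs = 1 \<Longrightarrow> run e p xs = Some (f p (xs ! 0))"
    using assms by (rule recursiveE) blast
  have "run e p [n] = Some (f p n)" for p n
    using e[of "[n]" p] by simp
  then have "(\<lambda>p. Some (f p)) = functional e"
    by (simp add: functional_def fun_eq_iff)
  then show ?thesis
    unfolding computable_def by blast
qed

lemma those_run_Proj:
  "\<forall>i\<in>set is. j i < length xs \<Longrightarrow>
    those (map (\<lambda>g. run g p xs) (map (\<lambda>i. Proj (j i)) is)) = Some (map (\<lambda>i. xs ! j i) is)"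
  by (induction "is") auto

lemma recursive_nth: "i < k \<Longrightarrow> recursive k (\<lambda>p xs. xs ! i)"
  by (rule recursiveI[of _ "Proj i"]) simp

lemma recursive_Suc:
  assumes "recursive k f"
  shows "recursive k (\<lambda>p xs. Suc (f p xs))"
proof -
  obtain e where "\<And>p xs. length xs = k \<Longrightarrow> run e p xs = Some (f p xs)"
    using assms by (rule recursiveE) blast
  then show ?thesis
    by (intro recursiveI[of _ "Comp Succ [e]"]) simp
qed

lemma recursive_query:
  assumes "recursive k f"
  shows "recursive k (\<lambda>p xs. p (f p xs))"
proof -
  obtain e where "\<And>p xs. length xs = k \<Longrightarrow> run e p xs = Some (f p xs)"
    using assms by (rule recursiveE) blast
  then show ?thesis
    by (intro recursiveI[of _ "Comp Query [e]"]) simp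
qed

lemma recursive_const: "recursive k (\<lambda>p xs. c)"
proof (induction c)
  case 0
  show ?case by (rule recursiveI[of _ Zero]) simp
next
  case (Suc c)
  then show ?case by (rule recursive_Suc)
qed

text \<open>Weakening by an additional first argument, needed below binders.\<close>

lemma recursive_tl:
  assumes "recursive k f"
  shows "recursive (Suc k) (\<lambda>p xs. f p (tl xs))"
proof -
  obtain e where e: "\<And>p xs. length xs = k \<Longrightarrow> run e p xs = Some (f p xs)"
    using assms by (rule recursiveE) blast
  show ?thesis
  proof (rule recursiveI[of _ "Comp e (map (\<lambda>i. Proj (Suc i)) [0..<k])"])
    fix p :: baire and xs :: "nat list"
    assume xs: "length xs = Suc k"
    then have "map (\<lambda>i. xs ! Suc i) [0..<k] = tl xs"
      by (intro nth_equalityI) (auto simp: nth_tl)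
    with xs have "those (map (\<lambda>g. run g p xs) (map (\<lambda>i. Proj (Suc i)) [0..<k])) = Some (tl xs)"
      by (subst those_run_Proj) auto
    with xs show "run (Comp e (map (\<lambda>i. Proj (Suc i)) [0..<k])) p xs = Some (f p (tl xs))"
      by (simp only: run.simps(5)) (simp add: e)
  qed
qed

text \<open>The step function takes the counter and the accumulator as genuine variables, so that the rule
  matches any \<^const>\<open>rec_nat\<close> term by higher-order pattern unification.
  Inside the step, the old arguments are found behind two applications of \<^const>\<open>tl\<close>.\<close>

lemma recursive_rec_nat:
  assumes "recursive k b" "recursive (Suc (Suc k)) (\<lambda>p ys. s (ys ! 0) (ys ! 1) p (tl (tl ys)))"
    and "recursive k c"
  shows "recursive k (\<lambda>p xs. rec_nat (b p xs) (\<lambda>m r. s m r p xs) (c p xs))"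
proof -
  obtain eb where eb: "\<And>p xs. length xs = k \<Longrightarrow> run eb p xs = Some (b p xs)"
    using assms(1) by (rule recursiveE) blast
  obtain es where es: "\<And>p ys. length ys = Suc (Suc k) \<Longrightarrow>
      run es p ys = Some (s (ys ! 0) (ys ! 1) p (tl (tl ys)))"
    using assms(2) by (rule recursiveE) blast
  obtain ec where ec: "\<And>p xs. length xs = k \<Longrightarrow> run ec p xs = Some (c p xs)"
    using assms(3) by (rule recursiveE) blast
  show ?thesis
  proof (rule recursiveI[of _ "Comp (PrimRec eb es) (ec # map Proj [0..<k])"])
    fix p :: baire and xs :: "nat list"
    assume xs: "length xs = k"
    then have "map ((!) xs) [0..<k] = xs"
      by (intro nth_equalityI) auto
    with xs have "those (map (\<lambda>g. run g p xs) (map Proj [0..<k])) = Some xs"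
      using those_run_Proj[of "[0..<k]" "\<lambda>i. i" xs p] by simp
    with xs have args: "those (map (\<lambda>g. run g p xs) (ec # map Proj [0..<k])) = Some (c p xs # xs)"
      by (simp add: ec)
    have "rec_nat (run eb p xs) (\<lambda>m r. Option.bind r (\<lambda>y. run es p (m # y # xs))) n
        = Some (rec_nat (b p xs) (\<lambda>m r. s m r p xs) n)" for n
      using xs by (induction n) (simp_all add: eb es)
    then show "run (Comp (PrimRec eb es) (ec # map Proj [0..<k])) p xs
        = Some (rec_nat (b p xs) (\<lambda>m r. s m r p xs) (c p xs))"
      by (simp only: run.simps(5) args) simp
  qed
qed

lemma recursive_tl_tl:
  "recursive k f \<Longrightarrow> recursive (Suc (Suc k)) (\<lambda>p xs. f p (tl (tl xs)))"
  by (intro recursive_tl[where f = "\<lambda>p xs. f p (tl xs)"] recursive_tl)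

lemma recursive_add:
  assumes "recursive k f" "recursive k g"
  shows "recursive k (\<lambda>p xs. f p xs + g p xs)"
proof -
  have "m + n = rec_nat m (\<lambda>_ r. Suc r) n" for m n
    by (induction n) auto
  then show ?thesis
    using assms by (auto intro!: recursive_rec_nat recursive_Suc recursive_nth)
qed

lemma recursive_diff:
  assumes "recursive k f" "recursive k g"
  shows "recursive k (\<lambda>p xs. f p xs - g p xs)"
proof -
  have pred: "n - 1 = rec_nat 0 (\<lambda>m _. m) n" for n :: nat
    by (cases n) auto
  have "m - n = rec_nat m (\<lambda>_ r. r - 1) n" for m n :: nat
    by (induction n) auto
  then show ?thesis
    using assms unfolding pred
    by (auto intro!: recursive_rec_nat recursive_const recursive_nth)
qed

lemma recursive_if:
  assumes "recursive k (\<lambda>p xs. of_bool (P p xs))" "recursive k f" "recursive k g"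
  shows "recursive k (\<lambda>p xs. if P p xs then f p xs else g p xs)"
proof -
  have "(\<lambda>p xs. if P p xs then f p xs else g p xs)
      = (\<lambda>p xs. rec_nat (g p xs) (\<lambda>_ _. f p xs) (of_bool (P p xs)))"
    by (auto simp: fun_eq_iff)
  then show ?thesis
    using assms by (auto intro!: recursive_rec_nat recursive_tl_tl)
qed

lemma recursive_not:
  assumes "recursive k (\<lambda>p xs. of_bool (P p xs))"
  shows "recursive k (\<lambda>p xs. of_bool (\<not> P p xs))"
proof -
  have "(\<lambda>p xs. of_bool (\<not> P p xs) :: nat) = (\<lambda>p xs. 1 - of_bool (P p xs))"
    by (auto simp: fun_eq_iff)
  then show ?thesis
    using assms by (auto intro!: recursive_diff recursive_const)
qed

lemma recursive_conj:
  assumes "recursive k (\<lambda>p xs. of_bool (P p xs))" "recursive k (\<lambda>p xs. of_bool (Q p xs))"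
  shows "recursive k (\<lambda>p xs. of_bool (P p xs \<and> Q p xs))"
proof -
  have "(\<lambda>p xs. of_bool (P p xs \<and> Q p xs) :: nat) = (\<lambda>p xs. if P p xs then of_bool (Q p xs) else 0)"
    by (auto simp: fun_eq_iff)
  then show ?thesis
    using assms by (auto intro!: recursive_if recursive_const)
qed

lemma recursive_le:
  assumes "recursive k f" "recursive k g"
  shows "recursive k (\<lambda>p xs. of_bool (f p xs \<le> g p xs))"
proof -
  have "(\<lambda>p xs. of_bool (f p xs \<le> g p xs) :: nat) = (\<lambda>p xs. 1 - (f p xs - g p xs))"
    by (auto simp: fun_eq_iff)
  then show ?thesis
    using assms by (auto intro!: recursive_diff recursive_const)
qed

lemma recursive_eq:
  assumes "recursive k f" "recursive k g"
  shows "recursive k (\<lambda>p xs. of_bool (f p xs = g p xs))"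
  unfolding eq_iff using assms by (intro recursive_conj recursive_le)

lemma recursive_bounded_ex:
  assumes "recursive (Suc k) (\<lambda>p ys. of_bool (Q (ys ! 0) p (tl ys)))" "recursive k f"
  shows "recursive k (\<lambda>p xs. of_bool (\<exists>i < f p xs. Q i p xs))"
proof -
  have unroll: "of_bool (\<exists>i<n. Q i p xs) = rec_nat (0::nat) (\<lambda>m r. if Q m p xs then 1 else r) n"
    for n p xs
  proof (induction n)
    case (Suc n)
    have "(\<exists>i<Suc n. Q i p xs) \<longleftrightarrow> Q n p xs \<or> (\<exists>i<n. Q i p xs)"
      by (auto simp: less_Suc_eq)
    then show ?case
      using Suc by (simp del: One_nat_def of_bool_or_iff)
  qed simp
  \<comment> \<open>The recursor inserts its accumulator as second argument, which \<^term>\<open>Q\<close> has to skip.\<close>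
  have step: "recursive (Suc (Suc k)) (\<lambda>p ys. of_bool (Q (ys ! 0) p (tl (tl ys))))"
  proof -
    obtain e where e: "\<And>p ys. length ys = Suc k \<Longrightarrow> run e p ys = Some (of_bool (Q (ys ! 0) p (tl ys)))"
      using assms(1) by (rule recursiveE) blast
    show ?thesis
    proof (rule recursiveI[of _ "Comp e (Proj 0 # map (\<lambda>i. Proj (Suc (Suc i))) [0..<k])"])
      fix p :: baire and ys :: "nat list"
      assume ys: "length ys = Suc (Suc k)"
      have "map (\<lambda>i. ys ! Suc (Suc i)) [0..<k] = tl (tl ys)"
        using ys by (intro nth_equalityI) (auto simp: nth_tl)
      with ys have "those (map (\<lambda>g. run g p ys) (map (\<lambda>i. Proj (Suc (Suc i))) [0..<k])) = Some (tl (tl ys))"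
        by (subst those_run_Proj) auto
      with ys have "those (map (\<lambda>g. run g p ys) (Proj 0 # map (\<lambda>i. Proj (Suc (Suc i))) [0..<k]))
          = Some (ys ! 0 # tl (tl ys))"
        by simp
      with ys show "run (Comp e (Proj 0 # map (\<lambda>i. Proj (Suc (Suc i))) [0..<k])) p ys =
          Some (of_bool (Q (ys ! 0) p (tl (tl ys))))"
        by (simp only: run.simps(5)) (simp add: e)
    qed
  qed
  show ?thesis
    unfolding unroll using assms(2) step
    by (intro recursive_rec_nat recursive_if recursive_const recursive_nth) auto
qed

lemma recursive_triangle:
  assumes "recursive k f"
  shows "recursive k (\<lambda>p xs. triangle (f p xs))"
proof -
  have "triangle n = rec_nat 0 (\<lambda>m r. r + Suc m) n" for n
    by (induction n) auto
  then show ?thesis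
    using assms
    by (auto intro!: recursive_rec_nat recursive_add recursive_Suc recursive_const recursive_nth)
qed

lemma recursive_prod_encode:
  assumes "recursive k f" "recursive k g"
  shows "recursive k (\<lambda>p xs. prod_encode (f p xs, g p xs))"
  unfolding prod_encode_def using assms by (auto intro!: recursive_add recursive_triangle)

text \<open>The index of the diagonal of the pairing function on which a number lies, computed by counting
  upwards and stepping to the next diagonal whenever the present one is exhausted.\<close>

definition diagonal :: "nat \<Rightarrow> nat" where
  "diagonal = rec_nat 0 (\<lambda>m r. if triangle (Suc r) \<le> Suc m then Suc r else r)"

lemma prod_decode_diagonal:
  "prod_decode n = (n - triangle (diagonal n), diagonal n - (n - triangle (diagonal n)))"
proof -
  have "triangle (diagonal n) \<le> n \<and> n < triangle (Suc (diagonal n))"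
    by (induction n) (auto simp: diagonal_def)
  then have "prod_encode (n - triangle (diagonal n), diagonal n - (n - triangle (diagonal n))) = n"
    by (auto simp: prod_encode_def)
  then show ?thesis
    by (metis prod_encode_inverse)
qed

lemma recursive_prod_decode:
  assumes "recursive k f"
  shows "recursive k (\<lambda>p xs. fst (prod_decode (f p xs)))"
    and "recursive k (\<lambda>p xs. snd (prod_decode (f p xs)))"
proof -
  have "recursive k (\<lambda>p xs. diagonal (f p xs))"
    unfolding diagonal_def using assms
    by (auto intro!: recursive_rec_nat recursive_if recursive_le recursive_triangle recursive_Suc
        recursive_const recursive_nth simp del: triangle_Suc)
  then show "recursive k (\<lambda>p xs. fst (prod_decode (f p xs)))"
    "recursive k (\<lambda>p xs. snd (prod_decode (f p xs)))"
    unfolding prod_decode_diagonal using assms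
    by (auto intro!: recursive_diff recursive_triangle)
qed

lemmas recursive_intros =
  recursive_nth recursive_Suc recursive_query recursive_const
  recursive_rec_nat recursive_add recursive_diff recursive_if recursive_not recursive_conj
  recursive_le recursive_eq recursive_prod_encode recursive_prod_decode


section \<open>Continuity of computable functionals\<close>

text \<open>The neighbourhood filter in the product topology of Baire space. Phrasing continuity with
  filters lets the finitely many uses of the oracle be combined by \<open>eventually\<close> reasoning
  instead of maxima of use bounds.\<close>

definition nbhd :: "baire \<Rightarrow> baire filter" where
  "nbhd p = (INF N. principal {p'. \<forall>i<N. p' i = p i})"

lemma eventually_nbhd:
  "eventually Q (nbhd p) \<longleftrightarrow> (\<exists>N. \<forall>p'. (\<forall>i<N. p' i = p i) \<longrightarrow> Q p')"
proof -
  have "\<exists>x. {p'. \<forall>i<x. p' i = p i} \<subseteq> {p'. \<forall>i<a. p' i = p i} \<inter> {p'. \<forall>i<b. p' i = p i}" for a b :: nat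
    by (rule exI[of _ "max a b"]) auto
  then show ?thesis
    unfolding nbhd_def by (subst eventually_INF_base) (auto simp: eventually_principal)
qed

lemma eventually_nbhd_nth: "\<forall>\<^sub>F p' in nbhd p. p' i = p i"
  unfolding eventually_nbhd by (rule exI[of _ "Suc i"]) simp

text \<open>A terminating computation reads finitely many oracle positions. In the case of
  minimisation, the values below the least zero have to be preserved too: they must stay
  defined and positive.\<close>

lemma run_continuous: "run e p xs = Some y \<Longrightarrow> \<forall>\<^sub>F p' in nbhd p. run e p' xs = Some y"
proof (induction e arbitrary: xs y)
  case Query
  then obtain x ys where "xs = x # ys" "y = p x"
    by (cases xs) auto
  then show ?case
    using eventually_nbhd_nth[of x p] by simp
next
  case (Comp f gs)
  have *: "those (map (\<lambda>g. run g p xs) hs) = Some ys \<Longrightarrow>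
      \<forall>\<^sub>F p' in nbhd p. those (map (\<lambda>g. run g p' xs) hs) = Some ys" if "set hs \<subseteq> set gs" for hs ys
    using that
  proof (induction hs arbitrary: ys)
    case (Cons h hs)
    then obtain z zs where z: "run h p xs = Some z" "those (map (\<lambda>g. run g p xs) hs) = Some zs"
      "ys = z # zs"
      by (auto split: option.splits)
    have "\<forall>\<^sub>F p' in nbhd p. run h p' xs = Some z"
      using Comp.IH(2)[of h xs z] Cons.prems z by auto
    moreover have "\<forall>\<^sub>F p' in nbhd p. those (map (\<lambda>g. run g p' xs) hs) = Some zs"
      using Cons z by auto
    ultimately show ?case
      by eventually_elim (simp add: z)
  qed simp
  from Comp.prems obtain ys where ys: "those (map (\<lambda>g. run g p xs) gs) = Some ys" "run f p ys = Some y"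
    by (auto simp: bind_eq_Some_conv)
  from *[OF subset_refl ys(1)] Comp.IH(1)[OF ys(2)] show ?case
    by eventually_elim simp
next
  case (PrimRec f g)
  then obtain n ys where xs: "xs = n # ys"
    by (cases xs) auto
  let ?r = "\<lambda>p. rec_nat (run f p ys) (\<lambda>m r. Option.bind r (\<lambda>y. run g p (m # y # ys)))"
  have "?r p n = Some y \<Longrightarrow> \<forall>\<^sub>F p' in nbhd p. ?r p' n = Some y" for n y
  proof (induction n arbitrary: y)
    case 0
    then show ?case using PrimRec.IH(1) by simp
  next
    case (Suc n)
    then obtain z where z: "?r p n = Some z" "run g p (n # z # ys) = Some y"
      by (auto simp: bind_eq_Some_conv)
    from Suc.IH[OF z(1)] PrimRec.IH(2)[OF z(2)] show ?case
      by eventually_elim simp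
  qed
  then show ?case
    using PrimRec.prems by (simp add: xs)
next
  case (Minim f)
  let ?R = "\<lambda>p n. run f p (n # xs) = Some 0"
  from Minim.prems have ex: "\<exists>n. ?R p n \<and> (\<forall>m<n. run f p (m # xs) \<noteq> None)" and y: "y = (LEAST n. ?R p n)"
    by (auto split: if_splits)
  from ex obtain n where n: "?R p n" "\<forall>m<n. run f p (m # xs) \<noteq> None"
    by blast
  have Ry: "?R p y"
    unfolding y by (rule LeastI) (rule n)
  have "y \<le> n"
    unfolding y by (rule Least_le) (rule n)
  have below: "\<exists>z. run f p (m # xs) = Some (Suc z)" if "m < y" for m
  proof -
    from that have "\<not> ?R p m"
      unfolding y by (rule not_less_Least)
    moreover from that \<open>y \<le> n\<close> have "m < n"
      by simp
    then obtain z where "run f p (m # xs) = Some z"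
      using n(2) by auto
    ultimately show ?thesis
      by (cases z) auto
  qed
  have "\<forall>\<^sub>F p' in nbhd p. \<forall>m\<in>{..<y}. \<exists>z. run f p' (m # xs) = Some (Suc z)"
  proof (rule eventually_ball_finite, simp, rule ballI)
    fix m assume "m \<in> {..<y}"
    then obtain z where "run f p (m # xs) = Some (Suc z)"
      using below by blast
    from Minim.IH[OF this] show "\<forall>\<^sub>F p' in nbhd p. \<exists>z. run f p' (m # xs) = Some (Suc z)"
      by eventually_elim blast
  qed
  with Minim.IH[OF Ry] show ?case
  proof eventually_elim
    case (elim p')
    have "(LEAST n. ?R p' n) = y"
    proof (rule Least_equality)
      fix n
      assume "?R p' n"
      with elim(2) show "y \<le> n"
        by (metis Zero_neq_Suc lessThan_iff not_le option.inject)
    qed (rule elim)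
    moreover have "\<forall>m<y. run f p' (m # xs) \<noteq> None"
      using elim(2) by force
    ultimately show ?case
      using elim(1) by auto
  qed
qed auto

lemma functional_eq_SomeD: "functional e p = Some r \<Longrightarrow> run e p [n] = Some (r n)"
  by (auto simp: functional_def split: if_splits)

lemma functional_continuous:
  assumes "functional e p = Some r"
  shows "\<forall>\<^sub>F p' in nbhd p. \<forall>r'. functional e p' = Some r' \<longrightarrow> r' n = r n"
proof -
  from run_continuous[OF functional_eq_SomeD[OF assms, of n]] show ?thesis
    by eventually_elim (use functional_eq_SomeD in fastforce)
qed

lemma eventually_nbhd_join:
  assumes "eventually Q (nbhd (join p q))"
  shows "\<exists>N. \<forall>p' q'. (\<forall>i<N. p' i = p i) \<and> (\<forall>i<N. q' i = q i) \<longrightarrow> Q (join p' q')"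
proof -
  obtain N where "\<And>r. \<forall>i<N. r i = join p q i \<Longrightarrow> Q r"
    using assms unfolding eventually_nbhd by blast
  then show ?thesis
    by (intro exI[of _ N]) (auto simp: join_def)
qed


section \<open>Limits of columns\<close>

lemma limit_op_eq_Some_iff:
  "limit_op P = Some q \<longleftrightarrow> (\<forall>j. \<forall>\<^sub>F s in sequentially. P (prod_encode (s, j)) = q j)"
proof -
  have lim_eq: "lim (\<lambda>s. P (prod_encode (s, j))) = c"
    if "\<forall>\<^sub>F s in sequentially. P (prod_encode (s, j)) = c" for j c
    using that by (intro limI tendsto_eventually)
  show ?thesis
  proof
    assume "limit_op P = Some q"
    then have conv: "\<exists>c. \<forall>\<^sub>F s in sequentially. P (prod_encode (s, j)) = c"
      and q: "q j = lim (\<lambda>s. P (prod_encode (s, j)))" for j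
      unfolding limit_op_def by (auto split: if_splits)
    show "\<forall>j. \<forall>\<^sub>F s in sequentially. P (prod_encode (s, j)) = q j"
      using conv lim_eq q by metis
  next
    assume *: "\<forall>j. \<forall>\<^sub>F s in sequentially. P (prod_encode (s, j)) = q j"
    then have "lim (\<lambda>s. P (prod_encode (s, j))) = q j" for j
      using lim_eq by blast
    with * show "limit_op P = Some q"
      unfolding limit_op_def by auto
  qed
qed

lemma limit_op_eventually_const:
  assumes "\<forall>i\<ge>N. P i = c"
  shows "limit_op P = Some (\<lambda>_. c)"
  unfolding limit_op_eq_Some_iff eventually_sequentially
  using assms le_prod_encode_1 order_trans by blast

text \<open>Consequently no finite prefix of an input restricts the value of an iterated limit at 0.\<close>

lemma limit_iter_eventually_const:
  assumes "\<forall>i\<ge>N. P i = c" "k > 0"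
  shows "limit_iter k P = Some (\<lambda>_. c)"
  using assms(2)
proof (induction k rule: nat_induct_non_zero)
  case 1
  then show ?case
    by (simp add: limit_op_eventually_const[OF assms(1)])
next
  case (Suc k)
  then show ?case
    by (simp add: limit_op_eventually_const)
qed

lemma realizes_baire_problem: "realizes F (baire_problem F)"
  unfolding realizes_def baire_problem_def by auto

lemma realizes_baire_problemD:
  assumes "realizes G (baire_problem F)" "F p = Some q"
  shows "G p = Some q"
  using assms unfolding realizes_def baire_problem_def by fastforce

lemma cantor_problem_simps [simp]:
  "solutions (cantor_problem \<phi>) a = (if a \<in> cantor then {\<phi> a} else {})"
  "in_rep (cantor_problem \<phi>) = cantor_rep"
  "out_rep (cantor_problem \<phi>) = two_rep"
  by (simp_all add: cantor_problem_def)

lemma realizes_cantor_problem: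
  "realizes G (cantor_problem \<phi>) \<longleftrightarrow>
    (\<forall>p\<in>cantor. \<exists>q. G p = Some q \<and> two_rep q = Some (\<phi> p))"
  unfolding realizes_def by (auto simp: cantor_rep_def)

lemma two_rep_eq_Some_iff: "two_rep q = Some v \<longleftrightarrow> v = q 0 \<and> v \<in> {0, 1}"
  by (auto simp: two_rep_def)


section \<open>Two possible answers cannot encode a limit\<close>

text \<open>The realizer that answers with constant sequences makes the output of the reduction on an input
  depend only on the input and on one of two constants. On $0^\omega$ one constant makes the first
  output 0, and continues to do so on all extensions of some $0^N$, in particular on $0^N 1^\omega$.
  There the other constant has to produce 1, and does so on extensions of some $0^N 1^M$. On
  $0^N 1^M 2^\omega$ both constants are then committed to wrong outputs.\<close>

lemma baire_problem_not_le_cantor_problem: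
  assumes F: "\<And>p N c. \<forall>i\<ge>N. p i = c \<Longrightarrow> F p = Some (\<lambda>_. c)"
    and \<phi>: "\<And>a. a \<in> cantor \<Longrightarrow> \<phi> a \<in> {0, 1}"
  shows "\<not> baire_problem F \<le>\<^sub>W cantor_problem \<phi>"
proof
  assume "baire_problem F \<le>\<^sub>W cantor_problem \<phi>"
  then obtain K e where red: "\<And>G. realizes G (cantor_problem \<phi>) \<Longrightarrow>
      realizes (\<lambda>p. Option.bind (Option.bind (K p) G) (\<lambda>q. functional e (join p q))) (baire_problem F)"
    unfolding weihrauch_le_def computable_def by blast
  define G :: "baire \<rightharpoonup> baire" where "G q = Some (\<lambda>_. if \<phi> q = 0 then 0 else 1)" for q
  have "realizes G (cantor_problem \<phi>)"
    unfolding realizes_cantor_problem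
  proof
    fix a
    assume "a \<in> cantor"
    from \<phi>[OF this] show "\<exists>q. G a = Some q \<and> two_rep q = Some (\<phi> a)"
      by (auto simp: G_def two_rep_def)
  qed
  note G = realizes_baire_problemD[OF red[OF this]]
  have answer: "\<exists>i\<in>{0, 1}. run e (join p (\<lambda>_. i)) [0] = Some (q 0)" if "F p = Some q" for p q
    using G[OF that]
    by (cases "K p") (auto simp: G_def dest: functional_eq_SomeD split: if_splits)
  have frozen: "\<exists>N. \<forall>p'. (\<forall>i<N. p' i = p i) \<longrightarrow> run e (join p' c) [0] = Some y"
    if "run e (join p c) [0] = Some y" for p c y
    using eventually_nbhd_join[OF run_continuous[OF that]] by blast
  have "F (\<lambda>_. 0) = Some (\<lambda>_. 0)"
    using F[of 0 "\<lambda>_. 0" 0] by simp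
  then obtain i where i: "i \<in> {0, 1}" "run e (join (\<lambda>_. 0) (\<lambda>_. i)) [0] = Some 0"
    using answer by blast
  then obtain N where N: "\<And>p. \<forall>j<N. p j = 0 \<Longrightarrow> run e (join p (\<lambda>_. i)) [0] = Some 0"
    using frozen by metis
  define p where "p j = (if j < N then 0 else 1 :: nat)" for j
  have "F p = Some (\<lambda>_. 1)"
    using F[of N p 1] by (simp add: p_def)
  then obtain i' where i': "i' \<in> {0, 1}" "run e (join p (\<lambda>_. i')) [0] = Some 1"
    using answer by blast
  have "i' \<noteq> i"
    using i' N[of p] by (auto simp: p_def)
  from i' obtain N' where N': "\<And>p'. \<forall>j<N'. p' j = p j \<Longrightarrow> run e (join p' (\<lambda>_. i')) [0] = Some 1"
    using frozen by metis
  define p' where "p' j = (if j < max N N' then p j else 2)" for j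
  have "F p' = Some (\<lambda>_. 2)"
    by (intro F[of "max N N'"]) (auto simp: p'_def)
  then obtain i'' where i'': "i'' \<in> {0, 1}" "run e (join p' (\<lambda>_. i'')) [0] = Some 2"
    using answer by blast
  have "\<forall>j<N. p' j = 0" "\<forall>j<N'. p' j = p j"
    by (auto simp: p'_def p_def)
  from N[OF this(1)] N'[OF this(2)] i'' have "i'' \<noteq> i" "i'' \<noteq> i'"
    by auto
  with \<open>i' \<noteq> i\<close> i i' i'' show False
    by auto
qed


section \<open>INF is not a limit of continuous functionals\<close>

lemma inf_map_eq_1_iff: "inf_map a = 1 \<longleftrightarrow> infinite {j. a j = 1}"
  unfolding inf_map_def infinite_nat_iff_unbounded_le by auto

lemma inf_map_in: "inf_map a \<in> {0, 1}"
  by (simp add: inf_map_def)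

text \<open>The covering sets are left one by one. A sequence with finitely many ones lies in no member
  of the cover, and since each member is closed, a finite prefix suffices to be outside a given
  one. So after having built finitely many ones, enough zeros can be appended to leave
  the next member for good; then one more 1 is appended. The resulting sequence has infinitely many
  ones and lies in no member of the cover. Sequences are handled as sets of positions of ones.\<close>

lemma INF_not_countable_union_of_closed:
  fixes A :: "'w::countable \<Rightarrow> baire \<Rightarrow> bool"
  assumes closed: "\<And>w p. p \<in> cantor \<Longrightarrow> \<not> A w p \<Longrightarrow> \<forall>\<^sub>F p' in nbhd p. p' \<in> cantor \<longrightarrow> \<not> A w p'"
    and cover: "\<And>p. p \<in> cantor \<Longrightarrow> inf_map p = 1 \<longleftrightarrow> (\<exists>w. A w p)"
  shows False
proof -
  define ind :: "nat set \<Rightarrow> baire" where "ind S = (\<lambda>j. of_bool (j \<in> S))" for S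
  have ind: "ind S \<in> cantor" "inf_map (ind S) = 1 \<longleftrightarrow> infinite S" for S
    unfolding inf_map_eq_1_iff by (simp_all add: ind_def cantor_def)
  define avoids where "avoids w S m \<longleftrightarrow>
      (\<forall>p. p \<in> cantor \<and> (\<forall>i<m. p i = ind S i) \<longrightarrow> \<not> A w p)" for w S m
  have "\<exists>S. \<forall>n. finite (S n) \<and> (\<exists>m. S (Suc n) = insert m (S n) \<and> (\<forall>i\<in>S n. i < m) \<and>
      avoids (from_nat n) (S n) m)"
  proof (rule dependent_nat_choice)
    show "\<exists>S :: nat set. finite S"
      by blast
  next
    fix S :: "nat set" and n :: nat
    assume "finite S"
    then have "\<not> A (from_nat n) (ind S)"
      using cover[of "ind S"] ind by auto
    from closed[OF ind(1) this] obtain N where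
      N: "\<And>p. \<forall>i<N. p i = ind S i \<Longrightarrow> p \<in> cantor \<Longrightarrow> \<not> A (from_nat n) p"
      unfolding eventually_nbhd by blast
    from \<open>finite S\<close> obtain M where M: "\<forall>i\<in>S. i < M"
      using finite_nat_set_iff_bounded by blast
    show "\<exists>S'. finite S' \<and> (\<exists>m. S' = insert m S \<and> (\<forall>i\<in>S. i < m) \<and> avoids (from_nat n) S m)"
      using \<open>finite S\<close> N M
      by (intro exI[of _ "insert (max N M) S"] conjI exI[of _ "max N M"]) (auto simp: avoids_def)
  qed
  then obtain S m where S: "\<And>n. S (Suc n) = insert (m n) (S n)" "\<And>n. \<forall>i\<in>S n. i < m n"
    "\<And>n. avoids (from_nat n) (S n) (m n)"
    by metis
  have mono: "S n \<subseteq> S n'" if "n \<le> n'" for n n'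
    using that by (rule lift_Suc_mono_le[rotated]) (auto simp: S)
  have "strict_mono m"
    unfolding strict_mono_Suc_iff using S(1,2) by (metis insertI1)
  let ?T = "\<Union>n. S n"
  have "range m \<subseteq> ?T"
    using S(1) by blast
  with \<open>strict_mono m\<close> have "infinite ?T"
    using finite_imageD finite_subset strict_mono_imp_inj_on infinite_UNIV_nat by metis
  then obtain w where w: "A w (ind ?T)"
    using cover[of "ind ?T"] ind by auto
  define n where "n = to_nat w"
  have "i \<in> S n" if i: "i < m n" "i \<in> S n'" for i n'
    using i(2)
  proof (induction n')
    case 0
    then show ?case using mono[of 0 n] by auto
  next
    case (Suc n')
    have "m n \<le> m n'" if "n \<le> n'"
      using that \<open>strict_mono m\<close> by (simp add: strict_mono_less_eq)
    then show ?case
      using Suc mono[of "Suc n'" n] i(1) S(1)[of n'] by (cases "n \<le> n'") auto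
  qed
  then have "\<forall>i<m n. ind ?T i = ind (S n) i"
    by (auto simp: ind_def)
  then show False
    using S(3)[of n] w ind(1) unfolding avoids_def n_def by auto
qed

text \<open>The closed sets are indexed by a finite prefix of the limit and a stage from which
  the prefix is stable. The second condition quantifies over all continuations of the prefix, which
  is what makes its failure visible on a finite part of the input: it is witnessed by one halting
  computation with a fixed continuation.\<close>

lemma INF_not_limit_of_continuous:
  fixes k :: "baire \<Rightarrow> baire" and h :: "baire \<Rightarrow> nat option"
  assumes k: "\<And>p n. p \<in> cantor \<Longrightarrow> \<forall>\<^sub>F p' in nbhd p. p' \<in> cantor \<longrightarrow> k p' n = k p n"
    and h: "\<And>r y. h r = Some y \<Longrightarrow> \<forall>\<^sub>F r' in nbhd r. h r' = Some y"
    and correct: "\<And>p. p \<in> cantor \<Longrightarrow> \<exists>q. limit_op (k p) = Some q \<and> h (join p q) = Some (inf_map p)"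
  shows False
proof -
  define extends :: "baire \<Rightarrow> nat list \<Rightarrow> bool" where "extends q v \<longleftrightarrow> (\<forall>j<length v. q j = v ! j)" for q v
  define A :: "nat list \<times> nat \<Rightarrow> baire \<Rightarrow> bool" where
    "A = (\<lambda>(v, s0) p. (\<forall>s\<ge>s0. extends (\<lambda>j. k p (prod_encode (s, j))) v) \<and>
        (\<forall>q y. extends q v \<longrightarrow> h (join p q) = Some y \<longrightarrow> y = 1))"
  show False
  proof (rule INF_not_countable_union_of_closed)
    fix w p
    assume p: "p \<in> cantor" and "\<not> A w p"
    obtain v s0 where w: "w = (v, s0)"
      by (cases w)
    from \<open>\<not> A w p\<close> consider
        (col) s j where "s \<ge> s0" "j < length v" "k p (prod_encode (s, j)) \<noteq> v ! j"
      | (out) q y where "extends q v" "h (join p q) = Some y" "y \<noteq> 1"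
      unfolding A_def w extends_def by auto
    then show "\<forall>\<^sub>F p' in nbhd p. p' \<in> cantor \<longrightarrow> \<not> A w p'"
    proof cases
      case col
      from k[OF p, of "prod_encode (s, j)"] show ?thesis
        by eventually_elim (use col in \<open>auto simp: A_def w extends_def\<close>)
    next
      case out
      from eventually_nbhd_join[OF h[OF out(2)]] obtain N where
        "\<And>p'. \<forall>i<N. p' i = p i \<Longrightarrow> h (join p' q) = Some y"
        by blast
      then show ?thesis
        using out unfolding eventually_nbhd A_def w by (intro exI[of _ N]) auto
    qed
  next
    fix p
    assume p: "p \<in> cantor"
    then obtain q where q: "limit_op (k p) = Some q" "h (join p q) = Some (inf_map p)"
      using correct by blast
    have col: "\<forall>\<^sub>F s in sequentially. k p (prod_encode (s, j)) = q j" for j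
      using q(1) unfolding limit_op_eq_Some_iff by blast
    show "inf_map p = 1 \<longleftrightarrow> (\<exists>w. A w p)"
    proof
      assume "inf_map p = 1"
      then obtain N where N: "\<And>q'. \<forall>i<N. q' i = q i \<Longrightarrow> h (join p q') = Some 1"
        using eventually_nbhd_join[OF h[OF q(2)]] by auto
      have "\<forall>\<^sub>F s in sequentially. \<forall>j\<in>{..<N}. k p (prod_encode (s, j)) = q j"
        by (intro eventually_ball_finite ballI col) simp
      then obtain s0 where "\<And>s j. s \<ge> s0 \<Longrightarrow> j < N \<Longrightarrow> k p (prod_encode (s, j)) = q j"
        unfolding eventually_sequentially by auto
      then have "A (map q [0..<N], s0) p"
        using N by (auto simp: A_def extends_def)
      then show "\<exists>w. A w p" ..
    next
      assume "\<exists>w. A w p"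
      then obtain v s0 where A: "A (v, s0) p"
        by auto
      have "q j = v ! j" if "j < length v" for j
      proof -
        have "\<forall>\<^sub>F s in sequentially. k p (prod_encode (s, j)) = v ! j"
          using A that unfolding eventually_sequentially A_def extends_def by auto
        with col[of j] have "\<forall>\<^sub>F s in sequentially. q j = v ! j"
          by eventually_elim simp
        then show ?thesis
          by simp
      qed
      then show "inf_map p = 1"
        using A q(2) unfolding A_def extends_def by blast
    qed
  qed
qed

text \<open>The form in which both lower bounds are applied: \<^term>\<open>K\<close> is a partial functional that is
  continuous where defined, and at most one limit is taken.\<close>

lemma INF_not_single_limit:
  fixes K :: "baire \<rightharpoonup> baire" and h :: "baire \<Rightarrow> nat option"
  assumes "m < 2"
    and K: "\<And>p r n. p \<in> cantor \<Longrightarrow> K p = Some r \<Longrightarrow>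
      \<forall>\<^sub>F p' in nbhd p. \<forall>r'. K p' = Some r' \<longrightarrow> r' n = r n"
    and h: "\<And>r y. h r = Some y \<Longrightarrow> \<forall>\<^sub>F r' in nbhd r. h r' = Some y"
    and correct: "\<And>p. p \<in> cantor \<Longrightarrow>
      \<exists>r q. K p = Some r \<and> limit_iter m r = Some q \<and> h (join p q) = Some (inf_map p)"
  shows False
proof -
  have the_K: "\<forall>\<^sub>F p' in nbhd p. p' \<in> cantor \<longrightarrow> the (K p') n = the (K p) n" if p: "p \<in> cantor" for p n
  proof -
    from correct[OF p] obtain r where r: "K p = Some r"
      by blast
    from K[OF p r, of n] show ?thesis
    proof eventually_elim
      case (elim p')
      then show ?case
        using r correct[of p'] by auto
    qed
  qed
  \<comment> \<open>For no limit at all, the output is presented as the limit of a constant sequence.\<close>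
  define k where "k p = (if m = 0 then \<lambda>i. the (K p) (snd (prod_decode i)) else the (K p))" for p
  show False
  proof (rule INF_not_limit_of_continuous)
    show "\<forall>\<^sub>F p' in nbhd p. p' \<in> cantor \<longrightarrow> k p' n = k p n" if "p \<in> cantor" for p n
      using the_K[OF that] by (simp add: k_def)
    show "\<exists>q. limit_op (k p) = Some q \<and> h (join p q) = Some (inf_map p)" if p: "p \<in> cantor" for p
    proof -
      from correct[OF p] obtain r q where
        r: "K p = Some r" "limit_iter m r = Some q" "h (join p q) = Some (inf_map p)"
        by blast
      have "limit_op (k p) = Some q"
      proof (cases "m = 0")
        case True
        with r show ?thesis
          by (simp add: limit_op_eq_Some_iff k_def)
      next
        case False
        with \<open>m < 2\<close> have "m = Suc 0"
          by simp
        with r show ?thesis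
          by (simp add: k_def)
      qed
      with r(3) show ?thesis
        by blast
    qed
  qed (rule h)
qed

lemma INF_not_le_Lim_iter:
  assumes "m < 2"
  shows "\<not> INF_problem \<le>\<^sub>W Lim_iter_problem m"
proof
  assume "INF_problem \<le>\<^sub>W Lim_iter_problem m"
  then obtain eK eH where red: "\<And>G. realizes G (Lim_iter_problem m) \<Longrightarrow> realizes (\<lambda>p.
      Option.bind (Option.bind (functional eK p) G) (\<lambda>q. functional eH (join p q))) INF_problem"
    unfolding weihrauch_le_def computable_def by blast
  have "realizes (limit_iter m) (Lim_iter_problem m)"
    unfolding Lim_iter_problem_def by (rule realizes_baire_problem)
  note R = red[OF this, unfolded INF_problem_def realizes_cantor_problem, rule_format]
  show False
  proof (rule INF_not_single_limit[OF assms])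
    show "\<forall>\<^sub>F p' in nbhd p. \<forall>r'. functional eK p' = Some r' \<longrightarrow> r' n = r n"
      if "functional eK p = Some r" for p r n
      by (rule functional_continuous[OF that])
    show "run eH r [0] = Some y \<Longrightarrow> \<forall>\<^sub>F r' in nbhd r. run eH r' [0] = Some y" for r y
      by (rule run_continuous)
    show "\<exists>r q. functional eK p = Some r \<and> limit_iter m r = Some q \<and>
        run eH (join p q) [0] = Some (inf_map p)" if "p \<in> cantor" for p
    proof -
      from R[OF that] obtain r q s where "functional eK p = Some r" "limit_iter m r = Some q"
        "functional eH (join p q) = Some s" "s 0 = inf_map p"
        by (auto simp: bind_eq_Some_conv two_rep_eq_Some_iff)
      then show ?thesis
        using functional_eq_SomeD[of eH "join p q" s 0] by auto
    qed
  qed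
qed


section \<open>INF as a double limit\<close>

definition one_between :: "baire \<Rightarrow> nat \<Rightarrow> nat \<Rightarrow> bool" where
  "one_between b s t \<longleftrightarrow> (\<exists>j<Suc t. s \<le> j \<and> b j = 1)"

lemma eventually_one_between:
  "\<forall>\<^sub>F t in sequentially. one_between b s t \<longleftrightarrow> (\<exists>j\<ge>s. b j = 1)"
proof (cases "\<exists>j\<ge>s. b j = 1")
  case True
  then obtain j where "j \<ge> s" "b j = 1"
    by blast
  then have "one_between b s t" if "t \<ge> j" for t
    unfolding one_between_def using that by (intro exI[of _ j]) simp
  with True show ?thesis
    unfolding eventually_sequentially by blast
next
  case False
  then have "\<not> one_between b s t" for t
    by (auto simp: one_between_def)
  with False show ?thesis
    by simp
qed

text \<open>At position $\langle t, \langle s, i \rangle \rangle$ the limit over $t$ is taken first, then that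
  over $s$; the remaining index $i$ runs along the constant output sequence.\<close>

definition double_limit_name :: "baire \<Rightarrow> baire" where
  "double_limit_name b n = (let (t, r) = prod_decode n in of_bool (one_between b (fst (prod_decode r)) t))"

lemma limit_iter_double_limit_name: "limit_iter 2 (double_limit_name b) = Some (\<lambda>_. inf_map b)"
proof -
  have "limit_op (double_limit_name b) = Some (\<lambda>r. of_bool (\<exists>j\<ge>fst (prod_decode r). b j = 1))"
    unfolding limit_op_eq_Some_iff
  proof
    fix r
    from eventually_one_between[of b "fst (prod_decode r)"]
    show "\<forall>\<^sub>F t in sequentially. double_limit_name b (prod_encode (t, r)) =
        of_bool (\<exists>j\<ge>fst (prod_decode r). b j = 1)"
      by eventually_elim (simp add: double_limit_name_def)
  qed
  moreover have "limit_op (\<lambda>r. of_bool (\<exists>j\<ge>fst (prod_decode r). b j = 1)) = Some (\<lambda>_. inf_map b)"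
  proof (cases "\<forall>N. \<exists>j\<ge>N. b j = 1")
    case True
    then show ?thesis
      by (simp add: limit_op_eq_Some_iff inf_map_def)
  next
    case False
    then obtain N where "\<And>j. j \<ge> N \<Longrightarrow> b j \<noteq> 1"
      by blast
    then have "\<not> (\<exists>j\<ge>s. b j = 1)" if "s \<ge> N" for s
      using that order_trans by blast
    with False show ?thesis
      unfolding limit_op_eq_Some_iff eventually_sequentially inf_map_def by (auto intro!: exI[of _ N])
  qed
  ultimately show ?thesis
    by (simp add: numeral_2_eq_2)
qed

lemma recursive_one_between:
  assumes b: "\<And>k f. recursive k f \<Longrightarrow> recursive k (\<lambda>p xs. b p (f p xs))"
    and "recursive k f" "recursive k g"
  shows "recursive k (\<lambda>p xs. of_bool (one_between (b p) (f p xs) (g p xs)))"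
  unfolding one_between_def using assms
  by (intro recursive_bounded_ex recursive_conj recursive_le recursive_eq recursive_const b
      recursive_nth recursive_Suc recursive_tl[of _ f]) auto

lemma computable_double_limit_name:
  assumes "\<And>k f. recursive k f \<Longrightarrow> recursive k (\<lambda>p xs. b p (f p xs))"
  shows "computable (\<lambda>p. Some (double_limit_name (b p)))"
  unfolding double_limit_name_def case_prod_beta Let_def
  by (intro computable_if_recursive recursive_one_between[of b] assms recursive_intros) auto

text \<open>Position 1 of the interleaving of input and oracle answer is the first entry of the answer.\<close>

lemma computable_first_of_answer: "computable (\<lambda>r. Some (\<lambda>_. r 1))"
  by (intro computable_if_recursive recursive_intros)

lemma INF_le_Lim_iter_2: "INF_problem \<le>\<^sub>W Lim_iter_problem 2"
  unfolding weihrauch_le_def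
proof (intro exI conjI allI impI)
  show "computable (\<lambda>p. Some (double_limit_name p))"
    by (rule computable_double_limit_name) (rule recursive_query)
  show "computable (\<lambda>r. Some (\<lambda>_. r 1))"
    by (rule computable_first_of_answer)
  fix G
  assume "realizes G (Lim_iter_problem 2)"
  then have "G (double_limit_name p) = Some (\<lambda>_. inf_map p)" for p
    unfolding Lim_iter_problem_def
    by (rule realizes_baire_problemD) (rule limit_iter_double_limit_name)
  then show "realizes (\<lambda>p. Option.bind (Option.bind (Some (double_limit_name p)) G)
      (\<lambda>q. Some (\<lambda>_. join p q 1))) INF_problem"
    unfolding INF_problem_def realizes_cantor_problem
    using inf_map_in by (auto simp: join_def two_rep_eq_Some_iff)
qed

lemma Inf_enat_eq_2:
  assumes "2 \<in> S" "\<And>m. m < 2 \<Longrightarrow> m \<notin> S"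
  shows "Inf (enat ` S) = 2"
proof (rule antisym)
  show "Inf (enat ` S) \<le> 2"
    using assms(1) by (intro Inf_lower) (auto simp: numeral_eq_enat)
  show "2 \<le> Inf (enat ` S)"
  proof (rule Inf_greatest)
    fix x
    assume "x \<in> enat ` S"
    then obtain m where "x = enat m" "m \<in> S"
      by blast
    with assms(2)[of m] show "2 \<le> x"
      by (cases "m < 2") (auto simp: numeral_eq_enat)
  qed
qed

lemma rk_lim_INF: "rk_lim INF_problem = 2"
  unfolding rk_lim_def
  by (rule Inf_enat_eq_2) (use INF_le_Lim_iter_2 INF_not_le_Lim_iter in auto)


section \<open>Evaluation tables\<close>

text \<open>Limits of fast Cauchy names are unique, so the definite description is harmless.\<close>

lemma cauchy_rep_eq_Some_iff:
  "cauchy_rep p = Some z \<longleftrightarrow> (\<forall>n. cmod (complex_of_code (p n) - z) \<le> 1 / 2 ^ n)"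
proof -
  let ?Q = "\<lambda>z. \<forall>n. cmod (complex_of_code (p n) - z) \<le> 1 / 2 ^ n"
  have "z = z'" if Q: "?Q z" "?Q z'" for z z'
  proof (rule ccontr)
    assume "z \<noteq> z'"
    then have "0 < cmod (z - z') / 2"
      by simp
    then obtain n where "(1 / 2) ^ n < cmod (z - z') / 2"
      using real_arch_pow_inv[of "cmod (z - z') / 2" "1 / 2"] by auto
    moreover have "cmod (z - z') \<le> cmod (complex_of_code (p n) - z) + cmod (complex_of_code (p n) - z')"
      using norm_triangle_ineq4[of "complex_of_code (p n) - z'" "complex_of_code (p n) - z"] by simp
    ultimately show False
      using Q[rule_format, of n] by (simp add: power_one_over)
  qed
  then have "?Q z \<Longrightarrow> (THE z. ?Q z) = z" for z
    by (intro the_equality) auto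
  then show ?thesis
    unfolding cauchy_rep_def by auto
qed

text \<open>Rounds the real part $(u - v) / (d + 1)$ of the coded number at $1/2$, without leaving the
  natural numbers.\<close>

definition bit_of_code :: "nat \<Rightarrow> nat" where
  "bit_of_code c = (let (m, d) = prod_decode (fst (prod_decode c)); (u, v) = prod_decode m
    in of_bool (Suc (v + v + d) < u + u))"

lemma bit_of_code_approx:
  assumes "b \<in> {0, 1}" "cmod (complex_of_code c - of_nat b) \<le> 1 / 4"
  shows "bit_of_code c = b"
proof -
  obtain m d where md: "prod_decode (fst (prod_decode c)) = (m, d)"
    by (cases "prod_decode (fst (prod_decode c))")
  obtain u v where uv: "prod_decode m = (u, v)"
    by (cases "prod_decode m")
  have "Re (complex_of_code c) = (real u - real v) / (real d + 1)"
    by (simp add: complex_of_code_def rat_of_code_def case_prod_beta md uv)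
  moreover have "\<bar>Re (complex_of_code c) - real b\<bar> \<le> 1 / 4"
    using order_trans[OF abs_Re_le_cmod assms(2)] by simp
  ultimately have "\<bar>(real u - real v) / (real d + 1) - real b\<bar> \<le> 1 / 4"
    by simp
  then have "(real u - real v) / (real d + 1) \<le> real b + 1 / 4"
    "real b - 1 / 4 \<le> (real u - real v) / (real d + 1)"
    by linarith+
  then have "real u - real v \<le> (real b + 1 / 4) * (real d + 1)"
    "(real b - 1 / 4) * (real d + 1) \<le> real u - real v"
    by (simp_all add: pos_divide_le_eq pos_le_divide_eq)
  then show ?thesis
    using assms(1) by (auto simp: bit_of_code_def md uv)
qed

text \<open>Precision $2^{-2}$ suffices to tell the values 0 and 1 apart.\<close>

definition table_bits :: "baire \<Rightarrow> baire" where
  "table_bits p j = bit_of_code (p (prod_encode (j, 2)))"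

lemma table_bits_of_name:
  assumes "a \<in> cantor" "table_rep P_INF p = Some (eval_table P_INF a)"
  shows "table_bits p = a"
proof
  fix j
  have "product_rep cauchy_rep p = Some (eval_table P_INF a)"
    using assms(2) by (auto simp: table_rep_def subspace_rep_def split: option.splits if_splits)
  then have "\<forall>j. cauchy_rep (\<lambda>n. p (prod_encode (j, n))) \<noteq> None"
    and "the (cauchy_rep (\<lambda>n. p (prod_encode (j, n)))) = of_nat (a j)"
    by (auto simp: product_rep_def eval_table_def P_INF_def fun_eq_iff split: if_splits)
  then have "cauchy_rep (\<lambda>n. p (prod_encode (j, n))) = Some (of_nat (a j))"
    by (metis option.collapse)
  then have "cmod (complex_of_code (p (prod_encode (j, 2))) - of_nat (a j)) \<le> 1 / 2 ^ 2"
    unfolding cauchy_rep_eq_Some_iff by blast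
  then show "table_bits p j = a j"
    unfolding table_bits_def using assms(1) by (intro bit_of_code_approx) (auto simp: cantor_def)
qed

lemma recursive_table_bits:
  assumes "recursive k f"
  shows "recursive k (\<lambda>p xs. table_bits p (f p xs))"
  unfolding table_bits_def bit_of_code_def case_prod_beta Let_def less_eq_Suc_le
  using assms by (intro recursive_intros)

text \<open>In row \<open>j\<close> the exact value $(a(j) - 0) / (0 + 1) + 0 i$ at every precision. This name
  depends continuously on the sequence, which transfers the lower bound from Cantor space to
  evaluation tables.\<close>

definition table_name :: "baire \<Rightarrow> baire" where
  "table_name a i = prod_encode (prod_encode (prod_encode (a (fst (prod_decode i)), 0), 0), 0)"

lemma table_rep_table_name:
  assumes "a \<in> cantor"
  shows "table_rep P_INF (table_name a) = Some (eval_table P_INF a)"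
proof -
  have dec: "prod_decode 0 = (0, 0)"
    by (simp add: prod_decode_def prod_decode_aux.simps)
  have "cauchy_rep (\<lambda>n. table_name a (prod_encode (j, n))) = Some (of_nat (a j))" for j
  proof -
    have "Complex (real (a j)) 0 = of_nat (a j)"
      by (simp add: complex_eq_iff)
    then show ?thesis
      unfolding cauchy_rep_eq_Some_iff
      by (simp add: table_name_def complex_of_code_def rat_of_code_def dec)
  qed
  then have "product_rep cauchy_rep (table_name a) = Some (eval_table P_INF a)"
    by (simp add: product_rep_def eval_table_def P_INF_def)
  then show ?thesis
    using assms by (simp add: table_rep_def subspace_rep_def P_INF_def)
qed

lemma eventually_nbhd_table_name:
  assumes "eventually Q (nbhd (table_name a))"
  shows "\<forall>\<^sub>F a' in nbhd a. Q (table_name a')"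
proof -
  obtain N where N: "\<And>p. \<forall>i<N. p i = table_name a i \<Longrightarrow> Q p"
    using assms unfolding eventually_nbhd by blast
  have "fst (prod_decode i) \<le> i" for i
    using le_prod_encode_1[of "fst (prod_decode i)" "snd (prod_decode i)"] by simp
  then have "Q (table_name a')" if "\<forall>i<N. a' i = a i" for a'
    using that by (intro N) (metis le_less_trans table_name_def)
  then show ?thesis
    unfolding eventually_nbhd by blast
qed

lemma SCI_lim_Comp_P_INF: "SCI_lim_Comp P_INF = 2"
proof -
  have P: "sci_dom P_INF = cantor" "sci_map P_INF = inf_map" "sci_target_rep P_INF = two_rep"
    by (simp_all add: P_INF_def)
  show ?thesis
    unfolding SCI_lim_Comp_def P
  proof (rule Inf_enat_eq_2, goal_cases)
    case 1
    have "computable (\<lambda>p. Some (double_limit_name (table_bits p)))"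
      by (rule computable_double_limit_name) (rule recursive_table_bits)
    moreover have "(limit_iter 2 \<circ>\<^sub>m (\<lambda>p. Some (double_limit_name (table_bits p)))) p = Some (\<lambda>_. inf_map a)"
      if "a \<in> cantor" "table_rep P_INF p = Some (eval_table P_INF a)" for a p
      using table_bits_of_name[OF that] by (simp add: map_comp_def limit_iter_double_limit_name)
    ultimately show ?case
      using inf_map_in by (fastforce simp: two_rep_eq_Some_iff)
  next
    case (2 m)
    show ?case
    proof
      assume "m \<in> {k. \<exists>K. computable K \<and> (\<forall>a\<in>cantor. \<forall>p. table_rep P_INF p = Some (eval_table P_INF a) \<longrightarrow>
          (\<exists>q. (limit_iter k \<circ>\<^sub>m K) p = Some q \<and> two_rep q = Some (inf_map a)))}"
      then obtain e where e: "\<And>a p. a \<in> cantor \<Longrightarrow> table_rep P_INF p = Some (eval_table P_INF a) \<Longrightarrow>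
          \<exists>q. (limit_iter m \<circ>\<^sub>m functional e) p = Some q \<and> two_rep q = Some (inf_map a)"
        unfolding computable_def by blast
      show False
      proof (rule INF_not_single_limit[OF 2])
        show "\<forall>\<^sub>F a' in nbhd a. \<forall>r'. functional e (table_name a') = Some r' \<longrightarrow> r' n = r n"
          if "functional e (table_name a) = Some r" for a r n
          by (rule eventually_nbhd_table_name) (rule functional_continuous[OF that])
        show "\<forall>\<^sub>F r' in nbhd r. Some (r' 1) = Some y" if "Some (r 1) = Some y" for r y
          using eventually_nbhd_nth[of 1 r] that by simp
        show "\<exists>r q. functional e (table_name a) = Some r \<and> limit_iter m r = Some q \<and>
            Some (join a q 1) = Some (inf_map a)" if "a \<in> cantor" for a
          using e[OF that table_rep_table_name[OF that]]
          by (auto simp: map_comp_Some_iff two_rep_eq_Some_iff join_def)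
      qed
    qed
  qed
qed


section \<open>INF and the derivative of LPO\<close>

text \<open>A $\Pi_2$ and a $\Sigma_2$ question can only be reduced to each other by negating the answer,
  so both reductions end with the same outer functional.\<close>

lemma strong_weihrauch_le_by_flip:
  assumes k: "computable (\<lambda>p. Some (k p))"
    and out: "out_rep f = two_rep" "out_rep g = two_rep"
    and red: "\<And>p u. in_rep f p = Some u \<Longrightarrow> solutions f u \<noteq> {} \<Longrightarrow>
      \<exists>u' b. in_rep g (k p) = Some u' \<and> solutions g u' = {b} \<and> 1 - b \<in> solutions f u"
  shows "f \<le>\<^sub>s\<^sub>W g"
  unfolding strong_weihrauch_le_def
proof (intro exI conjI allI impI)
  show "computable (\<lambda>p. Some (k p))"
    by (rule k)
  show "computable (\<lambda>q. Some (\<lambda>_. 1 - q 0))"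
    by (intro computable_if_recursive recursive_intros)
  fix G
  assume G: "realizes G g"
  show "realizes (\<lambda>p. Option.bind (Option.bind (Some (k p)) G) (\<lambda>q. Some (\<lambda>_. 1 - q 0))) f"
    unfolding realizes_def
  proof (intro allI impI, elim conjE)
    fix p u
    assume "in_rep f p = Some u" "solutions f u \<noteq> {}"
    from red[OF this] obtain u' b where
      u': "in_rep g (k p) = Some u'" "solutions g u' = {b}" "1 - b \<in> solutions f u"
      by blast
    then obtain q where "G (k p) = Some q" "two_rep q = Some b"
      using G unfolding realizes_def out by fastforce
    with u'(3) show "\<exists>q v. Option.bind (Option.bind (Some (k p)) G) (\<lambda>q. Some (\<lambda>_. 1 - q 0)) = Some q
        \<and> out_rep f q = Some v \<and> v \<in> solutions f u"
      by (auto simp: two_rep_eq_Some_iff out)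
  qed
qed

lemma derivative_simps [simp]:
  "solutions (derivative g) = solutions g"
  "in_rep (derivative g) = in_rep g \<circ>\<^sub>m limit_op"
  "out_rep (derivative g) = out_rep g"
  by (simp_all add: derivative_def)

definition quiet_after :: "baire \<Rightarrow> baire" where
  "quiet_after a n = (let (s, t) = prod_decode n in of_bool (\<not> one_between a t s))"

lemma INF_le_derivative_LPO: "INF_problem \<le>\<^sub>s\<^sub>W derivative LPO_problem"
proof (rule strong_weihrauch_le_by_flip)
  show "computable (\<lambda>p. Some (quiet_after p))"
    unfolding quiet_after_def case_prod_beta Let_def
    by (intro computable_if_recursive recursive_intros recursive_one_between[of "\<lambda>p. p"]) auto
  fix p u
  assume "in_rep INF_problem p = Some u" "solutions INF_problem u \<noteq> {}"
  then have p: "u = p" "p \<in> cantor"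
    by (auto simp: INF_problem_def cantor_rep_def split: if_splits)
  define q where "q t = (of_bool (\<not> (\<exists>j\<ge>t. p j = 1)) :: nat)" for t
  have "limit_op (quiet_after p) = Some q"
    unfolding limit_op_eq_Some_iff
  proof
    fix t
    from eventually_one_between[of p t]
    show "\<forall>\<^sub>F s in sequentially. quiet_after p (prod_encode (s, t)) = q t"
      by eventually_elim (simp add: quiet_after_def q_def)
  qed
  moreover have "q \<in> cantor"
    by (simp add: cantor_def q_def)
  moreover have "inf_map p = 1 - lpo_map q"
    by (auto simp: inf_map_def lpo_map_def q_def)
  ultimately show "\<exists>u' b. in_rep (derivative LPO_problem) (quiet_after p) = Some u' \<and>
      solutions (derivative LPO_problem) u' = {b} \<and> 1 - b \<in> solutions INF_problem u"
    using p by (simp add: LPO_problem_def INF_problem_def cantor_rep_def map_comp_def)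
qed (simp_all add: INF_problem_def LPO_problem_def)

text \<open>The counter is increased at stage \<open>n\<close> if row \<open>n\<close> refutes that the column to which
  the counter points is eventually 1. The counter value \<open>w\<close> points to column
  \<open>fst (prod_decode w)\<close>, so every column is visited at arbitrarily large counter values.\<close>

definition candidate :: "baire \<Rightarrow> nat \<Rightarrow> nat" where
  "candidate P = rec_nat 0 (\<lambda>n w. if P (prod_encode (n, fst (prod_decode w))) = 1 then w else Suc w)"

definition refutations :: "baire \<Rightarrow> baire" where
  "refutations P n = of_bool (P (prod_encode (n, fst (prod_decode (candidate P n)))) \<noteq> 1)"

lemma candidate_Suc: "candidate P (Suc n) = candidate P n + refutations P n"
  by (simp add: candidate_def refutations_def)

text \<open>If the counter stops, its candidate column is eventually 1. If instead column \<open>t\<close> is 1 from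
  stage \<open>s0\<close> on, the counter cannot pass a value that points to \<open>t\<close> and has not been passed at
  stage \<open>s0\<close>.\<close>

lemma inf_map_refutations:
  assumes P: "limit_op P = Some u"
  shows "inf_map (refutations P) = 1 \<longleftrightarrow> (\<forall>t. u t \<noteq> 1)"
proof -
  let ?c = "candidate P"
  have col: "\<forall>\<^sub>F s in sequentially. P (prod_encode (s, t)) = u t" for t
    using P unfolding limit_op_eq_Some_iff by blast
  have mono: "?c n \<le> ?c n'" if "n \<le> n'" for n n'
    using that by (rule lift_Suc_mono_le[rotated]) (simp add: candidate_Suc)
  show ?thesis
  proof
    assume "inf_map (refutations P) = 1"
    then have inf: "\<exists>n\<ge>N. refutations P n = 1" for N
      unfolding inf_map_def by (metis zero_neq_one)
    have unbounded: "\<exists>n. w \<le> ?c n" for w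
    proof (induction w)
      case (Suc w)
      then obtain n where n: "w \<le> ?c n" by blast
      from inf obtain n' where n': "n' \<ge> n" "refutations P n' = 1" by blast
      with n mono[OF n'(1)] have "Suc w \<le> ?c (Suc n')"
        by (simp add: candidate_Suc)
      then show ?case ..
    qed simp
    show "\<forall>t. u t \<noteq> 1"
    proof (intro allI notI)
      fix t
      assume "u t = 1"
      with col[of t] obtain s0 where s0: "\<And>s. s \<ge> s0 \<Longrightarrow> P (prod_encode (s, t)) = 1"
        unfolding eventually_sequentially by auto
      define w where "w = prod_encode (t, ?c s0)"
      have "?c s0 \<le> w"
        unfolding w_def by (rule le_prod_encode_2)
      have "?c n \<le> w" if "n \<ge> s0" for n
        using that
      proof (induction n rule: dec_induct)
        case base
        show ?case by fact
      next
        case (step n)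
        show ?case
        proof (cases "?c n = w")
          case True
          with s0[of n] step show ?thesis
            by (simp add: candidate_Suc refutations_def w_def)
        next
          case False
          with step show ?thesis
            by (auto simp: candidate_Suc refutations_def)
        qed
      qed
      then have "?c n \<le> w" for n
        using mono[of n "max n s0"] by (meson le_trans max.cobounded1 max.cobounded2)
      with unbounded[of "Suc w"] show False
        by (metis not_less_eq_eq)
    qed
  next
    assume u: "\<forall>t. u t \<noteq> 1"
    show "inf_map (refutations P) = 1"
    proof (rule ccontr)
      assume "inf_map (refutations P) \<noteq> 1"
      then obtain N where not_refuted: "\<And>n. n \<ge> N \<Longrightarrow> refutations P n \<noteq> 1"
        unfolding inf_map_def by metis
      then have stop: "refutations P n = 0" if "n \<ge> N" for n
        using not_refuted[OF that] by (simp add: refutations_def of_bool_def split: if_splits)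
      have const: "?c n = ?c N" if "n \<ge> N" for n
        using that by (induction n rule: dec_induct) (simp_all add: candidate_Suc stop)
      have "P (prod_encode (n, fst (prod_decode (?c N)))) = 1" if "n \<ge> N" for n
        using stop[OF that] const[OF that] by (simp add: refutations_def of_bool_def split: if_splits)
      then have "\<forall>\<^sub>F n in sequentially. P (prod_encode (n, fst (prod_decode (?c N)))) = 1"
        unfolding eventually_sequentially by blast
      with col[of "fst (prod_decode (?c N))"] have "\<forall>\<^sub>F n in sequentially. u (fst (prod_decode (?c N))) = 1"
        by eventually_elim simp
      with u show False
        by simp
    qed
  qed
qed

lemma derivative_LPO_le_INF: "derivative LPO_problem \<le>\<^sub>s\<^sub>W INF_problem"
proof (rule strong_weihrauch_le_by_flip)
  show "computable (\<lambda>P. Some (refutations P))"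
    unfolding refutations_def candidate_def
    by (intro computable_if_recursive recursive_intros) simp_all
  fix P u
  assume "in_rep (derivative LPO_problem) P = Some u" "solutions (derivative LPO_problem) u \<noteq> {}"
  then have u: "limit_op P = Some u" "u \<in> cantor"
    by (auto simp: LPO_problem_def cantor_rep_def map_comp_Some_iff split: if_splits)
  have "lpo_map u = 1 - inf_map (refutations P)"
    using inf_map_refutations[OF u(1)] inf_map_in[of "refutations P"] by (auto simp: lpo_map_def)
  moreover have "refutations P \<in> cantor"
    by (simp add: cantor_def refutations_def)
  ultimately show "\<exists>u' b. in_rep INF_problem (refutations P) = Some u' \<and>
      solutions INF_problem u' = {b} \<and> 1 - b \<in> solutions (derivative LPO_problem) u"
    using u(2) by (simp add: LPO_problem_def INF_problem_def cantor_rep_def)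
qed (simp_all add: INF_problem_def LPO_problem_def)


section \<open>The degree of INF\<close>

lemma Lim_iter_not_le_INF: "m > 0 \<Longrightarrow> \<not> Lim_iter_problem m \<le>\<^sub>W INF_problem"
  unfolding Lim_iter_problem_def INF_problem_def
  by (rule baire_problem_not_le_cantor_problem) (use limit_iter_eventually_const inf_map_in in blast)+

theorem theorem3p2:
  "INF_problem \<equiv>\<^sub>s\<^sub>W derivative LPO_problem \<and>
   SCI_lim_Comp P_INF = rk_lim INF_problem \<and>
   rk_lim INF_problem = 2 \<and>
   INF_problem <\<^sub>W Lim_iter_problem 2 \<and>
   \<not> INF_problem \<le>\<^sub>W Lim_problem \<and>
   \<not> Lim_problem \<le>\<^sub>W INF_problem"
proof -
  have "Lim_problem = Lim_iter_problem 1"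
    by (simp add: Lim_problem_def Lim_iter_problem_def map_comp_def)
  then show ?thesis
    using INF_le_derivative_LPO derivative_LPO_le_INF SCI_lim_Comp_P_INF rk_lim_INF
      INF_le_Lim_iter_2 Lim_iter_not_le_INF[of 1] Lim_iter_not_le_INF[of 2] INF_not_le_Lim_iter[of 1]
    by (simp add: strong_weihrauch_equiv_def weihrauch_less_def)
qed

end
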